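(* Let $M$ be a lattice of rank $n$ with $n\geq 2$. Then, up to translation and choice of a basis of $M$, there are exactly two full-dimensional lattice polytopes in $M_{\mathbb{Q}}$ which are inscribed in a rectangle and have exactly $n+2$ lattice points. They are $$A(n)=\mathrm{conv}(0,2e_1,e_2,\ldots,e_n)$$ and $$B(n)=\mathrm{conv}(0,e_1,\ldots,e_n,e_1+e_2),$$ where $e_1,\ldots,e_n$ is a basis of $M$.
   Context: A lattice $M$ of rank $n$ is a free abelian group of rank $n$; $N=\mathrm{Hom}(M,\mathbb{Z})$ is the dual lattice, $M_{\mathbb{Q}}=M\otimes_{\mathbb{Z}}\mathbb{Q}$, and $\langle\cdot,\cdot\rangle:N\times M\to\mathbb{Z}$ is the natural pairing, extended to $\mathbb{Q}$-coefficients. A lattice polytope $P\subseteq M_{\mathbb{Q}}$ is the convex hull of a finite subset of $M$; its lattice points are the elements of $P\cap M$. For a full-dimensional $P$, each facet is the intersection of $P$ with a hyperplane $\langle p,x\rangle=a$, where $p\in N$, $a\in\mathbb{Z}$ and $\langle p,x\rangle\leq a$ for all $x\in P$. The polytope $P$ is inscribed in a rectangle if there is a vertex $v_0\in P$ such that (1) the primitive vectors on the edges of $P$ containing $v_0$ (directed away from $v_0$) form a basis $e_1,\ldots,e_n$ of the lattice $M$; (2) for every inequality $\langle p,x\rangle\leq a$ on $P$ that corresponds to a facet of $P$ not passing through $v_0$ we have $\langle p,e_i\rangle\geq 0$ for all $i=1,\ldots,n$. *)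

theory Defs
  imports "HOL-Analysis.Finite_Cartesian_Product"
begin

section \<open>Rational vector spaces\<close>

text \<open>The convexity notions of HOL-Analysis are tied to real vector spaces; the polytopes here
  live in the rational vector space spanned by a lattice, so the analogues over the rationals are
  set up below, following the library's definitions.\<close>

class rat_vector = ab_group_add +
  fixes scaleQ :: "rat \<Rightarrow> 'a \<Rightarrow> 'a"  (infixr \<open>*\<^sub>Q\<close> 75)
  assumes scaleQ_add_right: "a *\<^sub>Q (x + y) = a *\<^sub>Q x + a *\<^sub>Q y"
    and scaleQ_add_left: "(a + b) *\<^sub>Q x = a *\<^sub>Q x + b *\<^sub>Q x"
    and scaleQ_scaleQ: "a *\<^sub>Q b *\<^sub>Q x = (a * b) *\<^sub>Q x"
    and scaleQ_one: "1 *\<^sub>Q x = x"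

global_interpretation rat_vector: vector_space "scaleQ :: rat \<Rightarrow> 'a \<Rightarrow> 'a::rat_vector"
  by unfold_locales (simp_all add: scaleQ_add_right scaleQ_add_left scaleQ_scaleQ scaleQ_one)

instantiation rat :: rat_vector
begin
definition scaleQ_rat_def: "scaleQ (a::rat) (x::rat) = a * x"
instance by standard (simp_all add: scaleQ_rat_def algebra_simps)
end

instantiation vec :: (rat_vector, finite) rat_vector
begin
definition scaleQ_vec_def: "scaleQ a (x :: 'a ^ 'b) = (\<chi> i. a *\<^sub>Q (x $ i))"
instance
  by standard
    (simp_all add: scaleQ_vec_def vec_eq_iff scaleQ_add_right scaleQ_add_left scaleQ_scaleQ
      scaleQ_one)
end

definition convexQ :: "'a::rat_vector set \<Rightarrow> bool"
  where "convexQ S \<longleftrightarrow>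
    (\<forall>x\<in>S. \<forall>y\<in>S. \<forall>u\<ge>0. \<forall>v\<ge>0. u + v = 1 \<longrightarrow> u *\<^sub>Q x + v *\<^sub>Q y \<in> S)"

text \<open>Dimension of the affine hull: the dimension of the space of directions, and \<open>-1\<close> for the
  empty set.\<close>

definition aff_dimQ :: "'a::rat_vector set \<Rightarrow> int"
  where "aff_dimQ S =
    (if S = {} then -1 else int (rat_vector.dim {x - y |x y. x \<in> S \<and> y \<in> S}))"

section \<open>Lattices\<close>

abbreviation scaleZ :: "int \<Rightarrow> 'a \<Rightarrow> 'a::rat_vector"
  where "scaleZ k x \<equiv> of_int k *\<^sub>Q x"

global_interpretation int_module: module "scaleZ :: int \<Rightarrow> 'a \<Rightarrow> 'a::rat_vector"
  by unfold_locales (simp_all add: scaleQ_add_right scaleQ_add_left scaleQ_scaleQ scaleQ_one)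

definition lattice_basis :: "'a::rat_vector set \<Rightarrow> 'a set \<Rightarrow> bool"
  where "lattice_basis M B \<longleftrightarrow> \<not> int_module.dependent B \<and> int_module.span B = M"

definition lattice_basis_seq :: "'a::rat_vector set \<Rightarrow> nat \<Rightarrow> (nat \<Rightarrow> 'a) \<Rightarrow> bool"
  where "lattice_basis_seq M n e \<longleftrightarrow> inj_on e {1..n} \<and> lattice_basis M (e ` {1..n})"

text \<open>\<open>M\<close> is a free abelian group of rank \<open>n\<close>, and the ambient rational vector space is
  \<open>M \<otimes> \<rat>\<close>: the canonical map from \<open>M \<otimes> \<rat>\<close> to the ambient space is always injective, because
  \<open>M\<close> is a subgroup of it, and it is surjective iff \<open>M\<close> spans over the rationals.\<close>

definition lattice_of_rank :: "'a::rat_vector set \<Rightarrow> nat \<Rightarrow> bool"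
  where "lattice_of_rank M n \<longleftrightarrow>
    (\<exists>B. finite B \<and> card B = n \<and> lattice_basis M B) \<and> rat_vector.span M = UNIV"

text \<open>\<open>Hom(M, \<int>)\<close>, every element being identified with its rational-linear extension to the
  ambient space; the pairing is then function application.\<close>

definition dual_lattice :: "'a::rat_vector set \<Rightarrow> ('a \<Rightarrow> rat) set"
  where "dual_lattice M = {p. Vector_Spaces.linear scaleQ (*) p \<and> p ` M \<subseteq> \<int>}"

definition primitive :: "'a::rat_vector set \<Rightarrow> 'a \<Rightarrow> bool"
  where "primitive M u \<longleftrightarrow>
    u \<in> M \<and> u \<noteq> 0 \<and> (\<forall>k. \<forall>w\<in>M. u = scaleZ k w \<longrightarrow> \<bar>k\<bar> = 1)"

section \<open>Lattice polytopes\<close>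

definition lattice_polytope :: "'a::rat_vector set \<Rightarrow> 'a set \<Rightarrow> bool"
  where "lattice_polytope M P \<longleftrightarrow> (\<exists>S. finite S \<and> S \<subseteq> M \<and> P = convexQ hull S)"

definition full_dimensional :: "'a::rat_vector set \<Rightarrow> bool"
  where "full_dimensional P \<longleftrightarrow> aff_dimQ P = aff_dimQ (UNIV :: 'a set)"

definition valid_ineq :: "'a::rat_vector set \<Rightarrow> 'a set \<Rightarrow> ('a \<Rightarrow> rat) \<Rightarrow> int \<Rightarrow> bool"
  where "valid_ineq M P p a \<longleftrightarrow> p \<in> dual_lattice M \<and> (\<forall>x\<in>P. p x \<le> of_int a)"

text \<open>Faces are cut out by supporting hyperplanes. For a lattice polytope it is no restriction
  that the normal is in the dual lattice and the right-hand side is an integer.\<close>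

definition lattice_face :: "'a::rat_vector set \<Rightarrow> 'a set \<Rightarrow> 'a set \<Rightarrow> bool"
  where "lattice_face M P F \<longleftrightarrow> (\<exists>p a. valid_ineq M P p a \<and> F = {x \<in> P. p x = of_int a})"

definition vertex_of :: "'a::rat_vector set \<Rightarrow> 'a set \<Rightarrow> 'a \<Rightarrow> bool"
  where "vertex_of M P v \<longleftrightarrow> lattice_face M P {v}"

definition edge_ofQ :: "'a::rat_vector set \<Rightarrow> 'a set \<Rightarrow> 'a set \<Rightarrow> bool"
  where "edge_ofQ M P F \<longleftrightarrow> lattice_face M P F \<and> aff_dimQ F = 1"

definition facet_ineq :: "'a::rat_vector set \<Rightarrow> 'a set \<Rightarrow> ('a \<Rightarrow> rat) \<Rightarrow> int \<Rightarrow> bool"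
  where "facet_ineq M P p a \<longleftrightarrow>
    valid_ineq M P p a \<and> aff_dimQ {x \<in> P. p x = of_int a} = aff_dimQ P - 1"

definition edge_directions :: "'a::rat_vector set \<Rightarrow> 'a set \<Rightarrow> 'a \<Rightarrow> 'a set"
  where "edge_directions M P v =
    {u. primitive M u \<and> (\<exists>F. edge_ofQ M P F \<and> v \<in> F \<and> (\<exists>c>0. v + c *\<^sub>Q u \<in> F))}"

definition inscribed_in_rectangle :: "'a::rat_vector set \<Rightarrow> 'a set \<Rightarrow> bool"
  where "inscribed_in_rectangle M P \<longleftrightarrow>
    (\<exists>v\<^sub>0. vertex_of M P v\<^sub>0 \<and>
      lattice_basis M (edge_directions M P v\<^sub>0) \<and>
      (\<forall>p a. facet_ineq M P p a \<and> p v\<^sub>0 \<noteq> of_int a \<longrightarrow>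
        (\<forall>u\<in>edge_directions M P v\<^sub>0. 0 \<le> p u)))"

section \<open>The classification\<close>

definition inscribed_polytopes :: "'a::rat_vector set \<Rightarrow> nat \<Rightarrow> 'a set set"
  where "inscribed_polytopes M k =
    {P. lattice_polytope M P \<and> full_dimensional P \<and> inscribed_in_rectangle M P \<and>
        finite (P \<inter> M) \<and> card (P \<inter> M) = k}"

text \<open>Equality up to a change of basis, i.e. an automorphism \<open>g\<close> of \<open>M\<close> (extended linearly), and a
  translation by a lattice vector.\<close>

definition lattice_equivalent :: "'a::rat_vector set \<Rightarrow> 'a set \<Rightarrow> 'a set \<Rightarrow> bool"
  where "lattice_equivalent M P Q \<longleftrightarrow>
    (\<exists>g t. Vector_Spaces.linear scaleQ scaleQ g \<and> bij_betw g M M \<and> t \<in> M \<and>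
      Q = (\<lambda>x. t + g x) ` P)"

definition polytope_A :: "nat \<Rightarrow> (nat \<Rightarrow> 'a::rat_vector) \<Rightarrow> 'a set"
  where "polytope_A n e = convexQ hull ({0, 2 *\<^sub>Q e 1} \<union> e ` {2..n})"

definition polytope_B :: "nat \<Rightarrow> (nat \<Rightarrow> 'a::rat_vector) \<Rightarrow> 'a set"
  where "polytope_B n e = convexQ hull ({0} \<union> e ` {1..n} \<union> {e 1 + e 2})"

end

theory Submission
  imports Defs
begin

text \<open>
  Let \<open>v\<^sub>0\<close> be the vertex of an inscribed polytope \<open>P\<close> at which the primitive edge directions form a
  lattice basis \<open>U\<close> (\<open>n\<close> vectors). Every edge at \<open>v\<^sub>0\<close> ends in a lattice point, so \<open>P\<close> contains
  \<open>v\<^sub>0\<close> and all \<open>v\<^sub>0 + u\<close> with \<open>u \<in> U\<close>. These are \<open>n + 1\<close> of the \<open>n + 2\<close> lattice points; write the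
  remaining one as \<open>v\<^sub>0 + w\<close>. A lattice polytope is the hull of its lattice points, so
  \<open>P = v\<^sub>0 + conv({0, w} \<union> U)\<close>, and it remains to find all possible \<open>w\<close>. For a polytope
  in this explicit form, faces are exhibited by functionals with prescribed values on \<open>U\<close>.

  The coordinates \<open>a\<^sub>u\<close> of \<open>w\<close> are nonnegative (\<open>coord_w_nonneg\<close>): they cannot all be nonpositive,
  because \<open>v\<^sub>0\<close> is a vertex, and if both signs occurred then some functional would vanish at \<open>w\<close> and
  be negative on \<open>U\<close>, so that \<open>w\<close> would span an edge at \<open>v\<^sub>0\<close>, whose direction is missing from \<open>U\<close>.
  If \<open>a\<^sub>k > 0\<close>, the points \<open>v\<^sub>0 + w\<close> and \<open>v\<^sub>0 + u\<close> for \<open>u \<noteq> k\<close> span a facet that avoids \<open>v\<^sub>0\<close>; its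
  normal takes the value \<open>1 - (\<Sum>u\<noteq>k. a\<^sub>u)\<close> at \<open>k\<close>, and the rectangle condition says that this is
  nonnegative (\<open>coord_sum_others_le_1\<close>). So all coordinates but any chosen positive one add up
  to at most 1, which leaves \<open>w = m k\<close> or \<open>w = k + l\<close>; in the first case \<open>2 k\<close> gives a lattice
  point, whence \<open>m = 2\<close> (\<open>extra_point\<close>). Thus \<open>w = b + c\<close> with \<open>b, c \<in> U\<close>, and a bijection of bases
  turns \<open>P\<close> into \<open>A(n)\<close> if \<open>b = c\<close> and into \<open>B(n)\<close> if \<open>b \<noteq> c\<close>.

  Conversely, the hull of \<open>{0, b + c} \<union> U\<close> is inscribed, with a proof uniform in \<open>b\<close> and \<open>c\<close>
  (\<open>hull_inscribed\<close>). Finally \<open>A(n)\<close> and \<open>B(n)\<close> differ because two lattice points of \<open>A(n)\<close> differ by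
  twice a nonzero lattice vector, while the coordinates on \<open>B(n)\<close> stay between 0 and 1
  (\<open>not_lattice_equivalent\<close>).
\<close>

section \<open>Linear functionals and convex hulls over the rationals\<close>

global_interpretation rat_pair: vector_space_pair
  "scaleQ :: rat \<Rightarrow> 'a \<Rightarrow> 'a::rat_vector" "scaleQ :: rat \<Rightarrow> 'b \<Rightarrow> 'b::rat_vector"
  by unfold_locales

abbreviation linearQ :: "('a::rat_vector \<Rightarrow> 'b::rat_vector) \<Rightarrow> bool"
  where "linearQ \<equiv> Vector_Spaces.linear scaleQ scaleQ"

lemma scaleQ_rat_eq_times: "(scaleQ :: rat \<Rightarrow> rat \<Rightarrow> rat) = (*)"
  by (intro ext) (simp add: scaleQ_rat_def)

lemma dual_lattice_iff: "p \<in> dual_lattice M \<longleftrightarrow> linearQ p \<and> (\<forall>x\<in>M. p x \<in> \<int>)"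
  by (auto simp: dual_lattice_def scaleQ_rat_eq_times)

lemmas linear_rules = rat_pair.linear_add rat_pair.linear_diff rat_pair.linear_scale
  rat_pair.linear_0 rat_pair.linear_neg

lemma linearI:
  assumes "\<And>x y. f (x + y) = f x + f y" "\<And>c x. f (c *\<^sub>Q x) = c *\<^sub>Q f x"
  shows "linearQ f"
  using assms by (simp add: Vector_Spaces.linear_iff rat_vector.vector_space_axioms)

lemmas linearQ_simps = linear_rules scaleQ_rat_eq_times

lemma convexQI:
  assumes "\<And>x y u v. x \<in> S \<Longrightarrow> y \<in> S \<Longrightarrow> 0 \<le> u \<Longrightarrow> 0 \<le> v \<Longrightarrow> u + v = 1 \<Longrightarrow> u *\<^sub>Q x + v *\<^sub>Q y \<in> S"
  shows "convexQ S"
  using assms by (simp add: convexQ_def)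

lemma convexQD:
  "convexQ S \<Longrightarrow> x \<in> S \<Longrightarrow> y \<in> S \<Longrightarrow> 0 \<le> u \<Longrightarrow> 0 \<le> v \<Longrightarrow> u + v = 1 \<Longrightarrow> u *\<^sub>Q x + v *\<^sub>Q y \<in> S"
  by (simp add: convexQ_def)

lemma convexQ_convexQ_hull: "convexQ (convexQ hull S)"
  by (rule hull_in) (fastforce simp: convexQ_def)

lemma convexQ_halfspace:
  fixes p :: "'a::rat_vector \<Rightarrow> rat"
  assumes "linearQ p"
  shows "convexQ {x. p x \<le> a}"
proof (rule convexQI, unfold mem_Collect_eq)
  fix x y and u v :: rat
  assume *: "p x \<le> a" "p y \<le> a" "0 \<le> u" "0 \<le> v" "u + v = 1"
  have "u * p x + v * p y \<le> u * a + v * a"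
    using * by (intro add_mono mult_left_mono) auto
  also have "\<dots> = a" using * by (simp flip: distrib_right)
  finally show "p (u *\<^sub>Q x + v *\<^sub>Q y) \<le> a"
    using assms by (simp add: linearQ_simps)
qed

lemma hull_le:
  fixes p :: "'a::rat_vector \<Rightarrow> rat"
  assumes "linearQ p" "\<And>x. x \<in> S \<Longrightarrow> p x \<le> a" "x \<in> convexQ hull S"
  shows "p x \<le> a"
  using hull_minimal[of S "{x. p x \<le> a}" convexQ] convexQ_halfspace[OF assms(1)] assms(2,3) by auto

lemma hull_ge:
  fixes p :: "'a::rat_vector \<Rightarrow> rat"
  assumes "linearQ p" "\<And>x. x \<in> S \<Longrightarrow> a \<le> p x" "x \<in> convexQ hull S"
  shows "a \<le> p x"
proof -
  have "linearQ (\<lambda>x. - p x)" by (rule rat_pair.linear_compose_neg[OF assms(1)])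
  from hull_le[OF this, of S "-a" x] assms show ?thesis by simp
qed

text \<open>The open half space \<open>p < a\<close> together with the hull of the generators on \<open>p = a\<close> is convex, since
a proper convex combination with a point of the open half space stays there; and it contains all
generators, hence their hull.\<close>

lemma face_subset_hull:
  fixes p :: "'a::rat_vector \<Rightarrow> rat"
  assumes p: "linearQ p" "\<And>x. x \<in> S \<Longrightarrow> p x \<le> a" and x: "x \<in> convexQ hull S" "p x = a"
  shows "x \<in> convexQ hull {s \<in> S. p s = a}"
proof -
  let ?H = "convexQ hull {s \<in> S. p s = a}"
  have H: "p y = a" if "y \<in> ?H" for y
    using hull_le[OF p(1) _ that, of a] hull_ge[OF p(1) _ that, of a] by force
  have "convexQ ({x. p x < a} \<union> ?H)"
  proof (rule convexQI)
    fix x y and u v :: rat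
    assume xy: "x \<in> {x. p x < a} \<union> ?H" "y \<in> {x. p x < a} \<union> ?H" and uv: "0 \<le> u" "0 \<le> v" "u + v = 1"
    have le: "p x \<le> a" "p y \<le> a" using xy H by force+
    consider "u = 0" | "v = 0" | "u > 0" "v > 0" "x \<in> ?H" "y \<in> ?H"
      | "u > 0" "v > 0" "p x < a \<or> p y < a" using xy uv by force
    then show "u *\<^sub>Q x + v *\<^sub>Q y \<in> {x. p x < a} \<union> ?H"
    proof cases
      case 3
      then show ?thesis using convexQD[OF convexQ_convexQ_hull] uv by blast
    next
      case 4
      have "u * p x + v * p y < u * a + v * a"
        using 4 le by (metis add_le_less_mono add_less_le_mono mult_le_cancel_left_pos mult_less_cancel_left_pos)
      also have "\<dots> = a" using uv by (simp flip: distrib_right)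
      finally show ?thesis using p(1) by (simp add: linearQ_simps)
    qed (use xy uv in simp_all)
  qed
  moreover have "S \<subseteq> {x. p x < a} \<union> ?H" using p(2) hull_inc[of _ "{s \<in> S. p s = a}" convexQ] by force
  ultimately show ?thesis using hull_minimal[of S "{x. p x < a} \<union> ?H" convexQ] x by blast
qed

lemma hull_singleton: "convexQ hull {x} = {x}"
proof (rule hull_unique)
  show "convexQ {x}" by (auto simp: convexQ_def simp flip: scaleQ_add_left)
qed auto

lemma hull_affine_image:
  assumes "linearQ g"
  shows "(\<lambda>x. t + g x) ` (convexQ hull S) = convexQ hull ((\<lambda>x. t + g x) ` S)"
proof -
  let ?f = "\<lambda>x. t + g x"
  have comb: "?f (u *\<^sub>Q x + v *\<^sub>Q y) = u *\<^sub>Q ?f x + v *\<^sub>Q ?f y" if "u + v = 1" for u v x y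
  proof -
    have "t = u *\<^sub>Q t + v *\<^sub>Q t" using that by (simp flip: scaleQ_add_left)
    then show ?thesis using assms by (simp add: linearQ_simps scaleQ_add_right algebra_simps)
  qed
  show ?thesis
  proof
    have "convexQ {x. ?f x \<in> convexQ hull (?f ` S)}"
      by (intro convexQI) (simp add: comb convexQD[OF convexQ_convexQ_hull])
    then have "convexQ hull S \<subseteq> {x. ?f x \<in> convexQ hull (?f ` S)}"
      by (intro hull_minimal) (auto intro: hull_inc)
    then show "?f ` (convexQ hull S) \<subseteq> convexQ hull (?f ` S)" by blast
  next
    have "convexQ (?f ` (convexQ hull S))"
    proof (rule convexQI)
      fix x y and u v :: rat
      assume "x \<in> ?f ` (convexQ hull S)" "y \<in> ?f ` (convexQ hull S)" and uv: "0 \<le> u" "0 \<le> v" "u + v = 1"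
      then obtain x' y' where *: "x = ?f x'" "y = ?f y'" "x' \<in> convexQ hull S" "y' \<in> convexQ hull S"
        by blast
      have "u *\<^sub>Q x' + v *\<^sub>Q y' \<in> convexQ hull S"
        using convexQD[OF convexQ_convexQ_hull] * uv by blast
      then show "u *\<^sub>Q x + v *\<^sub>Q y \<in> ?f ` (convexQ hull S)"
        unfolding *(1,2) comb[OF uv(3), symmetric] by blast
    qed
    then show "convexQ hull (?f ` S) \<subseteq> ?f ` (convexQ hull S)"
      by (intro hull_minimal) (auto intro: hull_inc)
  qed
qed

lemma hull_subset_span: "convexQ hull S \<subseteq> rat_vector.span S"
  by (rule hull_minimal)
    (auto intro!: convexQI rat_vector.span_add rat_vector.span_scale intro: rat_vector.span_base)

lemma hull_translation: "(\<lambda>x. t + x) ` (convexQ hull S) = convexQ hull ((\<lambda>x. t + x) ` S)"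
  using hull_affine_image[OF rat_vector.linear_id, of t S] by simp

lemma hull_lattice_points:
  assumes "lattice_polytope M P"
  shows "P = convexQ hull (P \<inter> M)"
proof -
  obtain S where S: "S \<subseteq> M" "P = convexQ hull S" using assms by (auto simp: lattice_polytope_def)
  have "S \<subseteq> P \<inter> M" using S hull_subset[of S convexQ] by blast
  then have "P \<subseteq> convexQ hull (P \<inter> M)" using S(2) hull_mono by metis
  moreover have "convexQ hull (P \<inter> M) \<subseteq> P" by (rule hull_minimal) (auto simp: S(2) convexQ_convexQ_hull)
  ultimately show ?thesis by blast
qed

section \<open>Coordinates with respect to a lattice basis\<close>

lemma common_denominator:
  fixes f :: "'i \<Rightarrow> rat"
  assumes "finite T"
  shows "\<exists>d::int. d \<noteq> 0 \<and> (\<forall>i\<in>T. of_int d * f i \<in> \<int>)"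
  using assms
proof induction
  case (insert j T)
  then obtain d where d: "d \<noteq> 0" "\<And>i. i \<in> T \<Longrightarrow> of_int d * f i \<in> \<int>" by blast
  obtain a b where ab: "f j = of_int a / of_int b" "b > 0"
    by (metis quotient_of_denom_pos quotient_of_div surj_pair)
  have "of_int (d * b) * f i \<in> \<int>" if "i \<in> insert j T" for i
  proof (cases "i = j")
    case True
    then have "of_int (d * b) * f i = of_int (d * a)" using ab by simp
    then show ?thesis by (metis Ints_of_int)
  next
    case False
    then have "of_int b * (of_int d * f i) \<in> \<int>" using that d(2) by (blast intro: Ints_mult Ints_of_int)
    then show ?thesis unfolding of_int_mult by (simp only: ac_simps)
  qed
  then show ?case using d ab by (intro exI[of _ "d * b"]) auto
qed (auto intro: exI[of _ 1])

text \<open>A rational linear relation becomes an integral one after multiplication by a common denominator.\<close>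

lemma lattice_basis_independentQ:
  assumes "lattice_basis M B"
  shows "\<not> rat_vector.dependent B"
proof
  assume "rat_vector.dependent B"
  then obtain T f where T: "finite T" "T \<subseteq> B" "(\<Sum>v\<in>T. f v *\<^sub>Q v) = 0" "\<exists>v\<in>T. f v \<noteq> 0"
    unfolding rat_vector.dependent_explicit by blast
  obtain d where d: "d \<noteq> 0" "\<And>i. i \<in> T \<Longrightarrow> of_int d * f i \<in> \<int>"
    using common_denominator[OF T(1), of f] by blast
  define g where "g v = \<lfloor>of_int d * f v\<rfloor>" for v
  have g: "of_int (g v) = of_int d * f v" if "v \<in> T" for v
    using d(2)[OF that] by (simp add: g_def)
  have "(\<Sum>v\<in>T. scaleZ (g v) v) = of_int d *\<^sub>Q (\<Sum>v\<in>T. f v *\<^sub>Q v)"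
    unfolding rat_vector.scale_sum_right by (intro sum.cong) (simp_all add: g)
  moreover have "\<exists>v\<in>T. g v \<noteq> 0" using T(4) d(1) g by (metis mult_eq_0_iff of_int_0 of_int_eq_0_iff)
  ultimately have "int_module.dependent B"
    unfolding int_module.dependent_explicit using T by (metis rat_vector.scale_zero_right)
  then show False using assms by (simp add: lattice_basis_def)
qed

text \<open>Most of the proof works with one basis of the lattice, taken as a set: the edge directions at the
distinguished vertex come without an enumeration.\<close>

locale lattice_coordinates =
  fixes M U :: "'a::rat_vector set"
  assumes basis: "lattice_basis M U" and span_M: "rat_vector.span M = UNIV" and finite_U: "finite U"
begin

lemma independent: "\<not> rat_vector.dependent U"
  by (rule lattice_basis_independentQ[OF basis])

lemma span_U: "rat_vector.span U = UNIV"
proof -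
  have "int_module.span U \<subseteq> rat_vector.span U"
    by (rule int_module.span_minimal)
      (auto simp: int_module.subspace_def rat_vector.span_base
        rat_vector.span_zero rat_vector.span_add rat_vector.span_scale)
  then have "M \<subseteq> rat_vector.span U"
    using basis by (simp add: lattice_basis_def)
  then show ?thesis using rat_vector.span_minimal[of M] span_M by auto
qed

sublocale fd: finite_dimensional_vector_space "scaleQ :: rat \<Rightarrow> 'a \<Rightarrow> 'a" U
  by unfold_locales (use finite_U independent span_U in auto)

definition coord :: "'a \<Rightarrow> 'a \<Rightarrow> rat"
  where "coord u x = rat_vector.representation U x u"

lemma linear_coord: "linearQ (coord u)"
  by (rule linearI)
    (simp_all add: coord_def rat_vector.representation_add rat_vector.representation_scale independent span_U scaleQ_rat_def)

lemmas coord_simps = linear_rules[OF linear_coord] scaleQ_rat_eq_times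

lemma coord_basis: "v \<in> U \<Longrightarrow> coord u v = (if u = v then 1 else 0)"
  by (auto simp: coord_def rat_vector.representation_basis independent)

lemma sum_coord: "(\<Sum>u\<in>U. coord u x *\<^sub>Q u) = x"
  unfolding coord_def
  by (rule rat_vector.sum_representation_eq) (auto simp: independent span_U finite_U)

lemma coord_eqI: "(\<And>u. u \<in> U \<Longrightarrow> coord u x = coord u y) \<Longrightarrow> x = y"
  by (subst (1 2) sum_coord[symmetric]) (simp cong: sum.cong)

lemma linear_expand: "linearQ f \<Longrightarrow> f x = (\<Sum>u\<in>U. coord u x *\<^sub>Q f u)"
  by (subst sum_coord[of x, symmetric]) (simp add: rat_pair.linear_sum rat_pair.linear_scale)

lemma basis_in_M: "u \<in> U \<Longrightarrow> u \<in> M"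
  using basis by (auto simp: lattice_basis_def int_module.span_base)

lemma M_closed:
  "0 \<in> M" "x \<in> M \<Longrightarrow> y \<in> M \<Longrightarrow> x + y \<in> M" "x \<in> M \<Longrightarrow> y \<in> M \<Longrightarrow> x - y \<in> M"
  "x \<in> M \<Longrightarrow> scaleZ k x \<in> M"
  using basis by (auto simp: lattice_basis_def int_module.span_zero int_module.span_add
      int_module.span_diff int_module.span_scale)

lemma coord_Ints:
  assumes "x \<in> M" "u \<in> U"
  shows "coord u x \<in> \<int>"
proof -
  have "int_module.span U \<subseteq> {x. \<forall>u\<in>U. coord u x \<in> \<int>}"
    by (rule int_module.span_minimal)
      (auto simp: int_module.subspace_def coord_simps coord_basis)
  then show ?thesis using assms basis by (auto simp: lattice_basis_def)
qed

lemma dual_latticeI: "linearQ p \<Longrightarrow> (\<And>u. u \<in> U \<Longrightarrow> p u \<in> \<int>) \<Longrightarrow> p \<in> dual_lattice M"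
  unfolding dual_lattice_iff
  by (subst linear_expand) (auto simp: coord_Ints scaleQ_rat_def intro!: Ints_sum Ints_mult)

text \<open>Functionals that cut out faces, and changes of basis, are prescribed on the basis.\<close>

lemma linear_extension:
  fixes f :: "'a \<Rightarrow> 'b::rat_vector"
  obtains g where "linearQ g" "\<And>u. u \<in> U \<Longrightarrow> g u = f u"
  using rat_pair.linear_independent_extend[OF independent, of f] by blast

lemma linear_maps_lattice:
  assumes g: "linearQ g" "\<And>u. u \<in> U \<Longrightarrow> g u \<in> M" and x: "x \<in> M"
  shows "g x \<in> M"
proof -
  have "scaleZ \<lfloor>coord u x\<rfloor> (g u) \<in> M" if "u \<in> U" for u using g(2)[OF that] by (rule M_closed)
  then have "(\<Sum>u\<in>U. scaleZ \<lfloor>coord u x\<rfloor> (g u)) \<in> int_module.span U"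
    using basis unfolding lattice_basis_def by (intro int_module.span_sum) simp
  also have "(\<Sum>u\<in>U. scaleZ \<lfloor>coord u x\<rfloor> (g u)) = g x"
    unfolding linear_expand[OF g(1), of x] using coord_Ints[OF x] by (intro sum.cong) auto
  finally show ?thesis using basis by (simp add: lattice_basis_def)
qed

lemma zero_notin_U: "0 \<notin> U"
  using independent rat_vector.dependent_zero by blast

section \<open>Dimensions of faces\<close>

lemma aff_dimQ_UNIV: "aff_dimQ (UNIV :: 'a set) = int (card U)"
proof -
  have "{x - y |x y. x \<in> (UNIV::'a set) \<and> y \<in> UNIV} = UNIV"
    by (auto intro: exI[of _ 0] diff_0_right[symmetric])
  then show ?thesis by (simp add: aff_dimQ_def)
qed

text \<open>Edges are faces of dimension 1; this lemma and the next one translate between that dimension and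
the parametrization of a line.\<close>

lemma collinear_of_aff_dimQ_1:
  fixes F :: "'a set"
  assumes F: "aff_dimQ F = 1" "x \<in> F" "y \<in> F" "z \<in> F" "y \<noteq> x"
  shows "\<exists>t. z - x = t *\<^sub>Q (y - x)"
proof (rule ccontr)
  let ?D = "{x - y |x y. x \<in> F \<and> y \<in> F}"
  assume "\<nexists>t. z - x = t *\<^sub>Q (y - x)"
  then have z: "z - x \<notin> rat_vector.span {y - x}" by (auto simp: rat_vector.span_singleton)
  have "\<not> rat_vector.dependent {y - x}" using F(5) by simp
  then have "\<not> rat_vector.dependent {z - x, y - x}"
    using z by (simp add: rat_vector.independent_insert)
  moreover have "{z - x, y - x} \<subseteq> ?D" using F by blast
  moreover have "z - x \<noteq> y - x" using z rat_vector.span_base by fastforce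
  ultimately have "2 \<le> rat_vector.dim ?D" using fd.independent_card_le_dim[of "{z - x, y - x}" ?D] by simp
  moreover have "rat_vector.dim ?D = 1" using F by (auto simp: aff_dimQ_def split: if_splits)
  ultimately show False by simp
qed

lemma aff_dimQ_segment:
  fixes F :: "'a set"
  assumes F: "\<And>y. y \<in> F \<Longrightarrow> \<exists>t. y = x + t *\<^sub>Q d" "x \<in> F" "y \<in> F" "y \<noteq> x"
  shows "aff_dimQ F = 1"
proof -
  let ?D = "{x - y |x y. x \<in> F \<and> y \<in> F}"
  have "?D \<subseteq> rat_vector.span {d}"
  proof clarify
    fix y z assume "y \<in> F" "z \<in> F"
    then obtain s t where "y = x + s *\<^sub>Q d" "z = x + t *\<^sub>Q d" using F(1) by meson
    then have "y - z = (s - t) *\<^sub>Q d" by (simp add: rat_vector.scale_left_diff_distrib)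
    then show "y - z \<in> rat_vector.span {d}" by (auto simp: rat_vector.span_singleton)
  qed
  then have "rat_vector.dim ?D \<le> 1" using rat_vector.dim_le_card[of ?D "{d}"] by simp
  moreover have "1 \<le> rat_vector.dim ?D"
    using fd.independent_card_le_dim[of "{y - x}" ?D] F by auto
  ultimately show ?thesis using F(2) by (auto simp: aff_dimQ_def)
qed

text \<open>The directions within a level set of \<open>p\<close> lie in the kernel of \<open>p\<close>.\<close>

lemma direction_notin_span:
  fixes p :: "'a \<Rightarrow> rat"
  assumes p: "linearQ p" "\<And>x. x \<in> F \<Longrightarrow> p x = a" and d: "p d \<noteq> 0"
  shows "d \<notin> rat_vector.span {x - y |x y. x \<in> F \<and> y \<in> F}"
proof -
  have "rat_vector.span {x - y |x y. x \<in> F \<and> y \<in> F} \<subseteq> {x. p x = 0}"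
    by (rule rat_vector.span_minimal)
      (use p in \<open>auto simp: rat_vector.subspace_def linearQ_simps\<close>)
  then show ?thesis using d by blast
qed

text \<open>A criterion for facets: one direction \<open>d\<close> transversal to the hyperplane completes the directions
inside to a spanning set, and the dimension drops by exactly one because \<open>d\<close> is not in their span.\<close>

lemma aff_dimQ_hyperplane_section:
  fixes p :: "'a \<Rightarrow> rat"
  assumes p: "linearQ p" "\<And>x. x \<in> F \<Longrightarrow> p x = a" and d: "p d \<noteq> 0"
    and spans: "U \<subseteq> rat_vector.span (insert d {x - y |x y. x \<in> F \<and> y \<in> F})" and "F \<noteq> {}"
  shows "aff_dimQ F = int (card U) - 1"
proof -
  let ?D = "{x - y |x y. x \<in> F \<and> y \<in> F}"
  have "rat_vector.span (insert d ?D) = UNIV"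
    using rat_vector.span_minimal[OF spans] span_U by auto
  then have "rat_vector.dim (insert d ?D) = card U" using fd.dim_eq_full[unfolded fd.dimension_def] by blast
  then have "rat_vector.dim ?D + 1 = card U"
    using direction_notin_span[OF assms(1-3)] by (simp add: fd.dim_insert)
  then show ?thesis using \<open>F \<noteq> {}\<close> by (simp add: aff_dimQ_def)
qed

text \<open>The directions of a facet have codimension one, and a point of the facet is independent of them
because the hyperplane misses the origin.\<close>

lemma span_facet:
  fixes p :: "'a \<Rightarrow> rat"
  assumes p: "linearQ p" "\<And>x. x \<in> F \<Longrightarrow> p x = a" "a \<noteq> 0" and F: "F \<noteq> {}" "aff_dimQ F = int (card U) - 1"
  shows "rat_vector.span F = UNIV"
proof -
  let ?D = "{x - y |x y. x \<in> F \<and> y \<in> F}"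
  obtain y where y: "y \<in> F" using F by blast
  have "rat_vector.dim (insert y ?D) = rat_vector.dim ?D + 1"
    using direction_notin_span[of p F a y] p y by (simp add: fd.dim_insert)
  also have "\<dots> = card U" using F by (simp add: aff_dimQ_def)
  finally have "rat_vector.span (insert y ?D) = UNIV" by (simp only: fd.dim_eq_full[unfolded fd.dimension_def])
  moreover have "rat_vector.span (insert y ?D) \<subseteq> rat_vector.span F"
    by (rule rat_vector.span_minimal) (use y in \<open>auto intro: rat_vector.span_base rat_vector.span_diff\<close>)
  ultimately show ?thesis by auto
qed

section \<open>Primitive vectors and the sum of the coordinates\<close>

lemma primitive_basis: "u \<in> U \<Longrightarrow> primitive M u"
  unfolding primitive_def
proof (intro conjI allI ballI impI)
  fix k w assume u: "u \<in> U" and w: "w \<in> M" "u = scaleZ k w"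
  then have "1 = of_int k * coord u w" using coord_basis[of u u] by (simp add: coord_simps)
  moreover obtain m where "coord u w = of_int m" using coord_Ints[OF w(1) u] by (auto elim: Ints_cases)
  ultimately have "k * m = 1" by (metis of_int_eq_1_iff of_int_mult)
  then show "\<bar>k\<bar> = 1" by (metis abs_zmult_eq_1 abs_1)
qed (use zero_notin_U basis_in_M in auto)

text \<open>Choose the factorization \<open>w = k y\<close> in the lattice with the largest \<open>k\<close>; a nonzero coordinate of
\<open>w\<close> bounds \<open>k\<close>.\<close>

lemma primitive_multiple:
  assumes w: "w \<in> M" "w \<noteq> 0"
  shows "\<exists>k y. 0 < k \<and> primitive M y \<and> w = scaleZ k y"
proof -
  let ?Q = "\<lambda>k::nat. \<exists>y\<in>M. w = scaleZ (int k) y"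
  have "\<exists>u\<in>U. coord u w \<noteq> coord u 0" using coord_eqI[of w 0] w(2) by blast
  then obtain u where u: "u \<in> U" "coord u w \<noteq> 0" unfolding coord_simps(4) by blast
  have bound: "k \<le> nat \<lceil>\<bar>coord u w\<bar>\<rceil>" if Q: "?Q k" for k
  proof -
    obtain y where y: "y \<in> M" "w = scaleZ (int k) y" using Q by blast
    have eq: "coord u w = of_nat k * coord u y" using y(2) by (simp add: coord_simps)
    obtain m where m: "coord u y = of_int m" using coord_Ints[OF y(1) u(1)] by (auto elim: Ints_cases)
    have "m \<noteq> 0" using eq m u(2) by auto
    then have "1 \<le> \<bar>coord u y\<bar>" using m by simp
    then have "of_nat k * 1 \<le> of_nat k * \<bar>coord u y\<bar>" by (intro mult_left_mono) auto
    also have "\<dots> = \<bar>coord u w\<bar>" by (simp add: eq abs_mult)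
    finally show ?thesis by linarith
  qed
  have "?Q 1" using w(1) by (intro bexI[of _ w]) simp_all
  then have "\<exists>k. ?Q k \<and> (\<forall>j. ?Q j \<longrightarrow> j \<le> k)"
    by (rule ex_has_greatest_nat[of ?Q 1 "\<lambda>k. k" "Suc (nat \<lceil>\<bar>coord u w\<bar>\<rceil>)"])
      (intro allI impI le_imp_less_Suc bound, assumption)
  then obtain k where k: "?Q k" and "\<forall>j. ?Q j \<longrightarrow> j \<le> k" by (elim exE conjE)
  then have greatest: "j \<le> k" if "?Q j" for j using that by simp
  obtain y where y: "y \<in> M" "w = scaleZ (int k) y" using k by blast
  have "k > 0" "y \<noteq> 0" using y(2) w(2) by (auto intro: Suc_leI)
  have "\<bar>j\<bar> = 1" if z: "z \<in> M" "y = scaleZ j z" for j z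
  proof -
    have "j \<noteq> 0" using z(2) \<open>y \<noteq> 0\<close> by auto
    have "w = scaleZ (int (k * nat \<bar>j\<bar>)) (scaleZ (sgn j) z)"
      unfolding y(2) z(2) scaleQ_scaleQ of_int_mult[symmetric]
      by (simp add: mult.assoc abs_mult_sgn)
    moreover have "scaleZ (sgn j) z \<in> M" using z(1) by (rule M_closed)
    ultimately have "k * nat \<bar>j\<bar> \<le> k" by (intro greatest) blast
    then show ?thesis using \<open>k > 0\<close> \<open>j \<noteq> 0\<close> by simp
  qed
  then have "primitive M y" using y(1) \<open>y \<noteq> 0\<close> by (auto simp: primitive_def)
  then show ?thesis using \<open>k > 0\<close> y(2) by (intro exI[of _ "int k"] exI[of _ y]) simp
qed

text \<open>The functional with value 1 on the basis. On the polytopes below it separates the lattice points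
into the layers 0, 1 and 2.\<close>

definition deg :: "'a \<Rightarrow> rat"
  where "deg x = (\<Sum>u\<in>U. coord u x)"

lemma linear_deg: "linearQ deg"
  by (rule linearI) (simp_all add: deg_def coord_simps sum.distrib sum_distrib_left)

lemmas deg_simps = linear_rules[OF linear_deg] scaleQ_rat_eq_times

lemma deg_basis: "u \<in> U \<Longrightarrow> deg u = 1"
  by (simp add: deg_def coord_basis finite_U)

section \<open>The polytopes spanned by a basis and a sum of two basis vectors\<close>

text \<open>The hull of \<open>G\<close> is \<open>A(n)\<close> for \<open>b = c\<close>, since a basis vector is the midpoint of 0 and its double, and
\<open>B(n)\<close> for \<open>b \<noteq> c\<close>. The steps towards \<open>hull_inscribed\<close> treat both at once.\<close>

context
  fixes b c G
  assumes bc: "b \<in> U" "c \<in> U"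
  defines "G \<equiv> insert 0 (insert (b + c) U)"
begin

lemma G_cases: "s \<in> G \<Longrightarrow> (s = 0 \<Longrightarrow> R) \<Longrightarrow> (s \<in> U \<Longrightarrow> R) \<Longrightarrow> (s = b + c \<Longrightarrow> R) \<Longrightarrow> R"
  by (auto simp: G_def)

lemma G_in: "0 \<in> convexQ hull G" "u \<in> U \<Longrightarrow> u \<in> convexQ hull G" "b + c \<in> convexQ hull G"
  by (rule hull_inc; simp add: G_def)+

lemma coord_nonneg: "u \<in> U \<Longrightarrow> s \<in> G \<Longrightarrow> 0 \<le> coord u s"
  using bc by (auto elim!: G_cases simp: coord_simps coord_basis)

lemma coord_nonneg_hull: "u \<in> U \<Longrightarrow> x \<in> convexQ hull G \<Longrightarrow> 0 \<le> coord u x"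
  by (rule hull_ge[OF linear_coord]) (auto intro: coord_nonneg)

lemma coord_le_1: "b \<noteq> c \<Longrightarrow> u \<in> U \<Longrightarrow> x \<in> convexQ hull G \<Longrightarrow> coord u x \<le> 1"
  by (rule hull_le[OF linear_coord, of G]) (use bc in \<open>auto elim!: G_cases simp: coord_simps coord_basis\<close>)

lemma deg_G: "s \<in> G \<Longrightarrow> deg s = (if s = 0 then 0 else if s = b + c then 2 else 1)"
  using bc by (auto elim!: G_cases simp: deg_simps deg_basis)

lemma sum_notin: "b + c \<notin> U" "b + c \<noteq> 0"
  using deg_basis[of "b + c"] deg_basis[OF bc(1)] deg_basis[OF bc(2)] by (auto simp: deg_simps dest!: arg_cong[of _ 0 deg])

text \<open>On a lattice point the coordinates are nonnegative integers with sum at most 2. Sum 0 gives the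
origin and sum 1 a basis vector; sum 2 is attained on a face with the single generator \<open>b + c\<close>.\<close>

lemma lattice_points: "(convexQ hull G) \<inter> M = G"
proof
  show "G \<subseteq> (convexQ hull G) \<inter> M"
    using bc by (auto elim!: G_cases simp: G_in M_closed basis_in_M)
  show "(convexQ hull G) \<inter> M \<subseteq> G"
  proof
    fix x assume x: "x \<in> (convexQ hull G) \<inter> M"
    have deg_le: "deg s \<le> 2" if "s \<in> G" for s using deg_G[OF that] by auto
    have nonneg: "0 \<le> coord u x" if "u \<in> U" for u using coord_nonneg_hull that x by blast
    have int: "coord u x \<in> \<int>" if "u \<in> U" for u using coord_Ints that x by blast
    consider "deg x = 2" | "\<And>u. u \<in> U \<Longrightarrow> coord u x = 0"
      | u where "deg x < 2" "u \<in> U" "coord u x \<noteq> 0"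
      using hull_le[OF linear_deg deg_le, of G x] x by force
    then show "x \<in> G"
    proof cases
      case 1
      then have "x \<in> convexQ hull {s \<in> G. deg s = 2}"
        using face_subset_hull[OF linear_deg deg_le] x by blast
      moreover have "{s \<in> G. deg s = 2} = {b + c}"
        using bc by (auto simp: G_def deg_simps deg_basis)
      ultimately have "x = b + c" by (simp add: hull_singleton)
      then show ?thesis by (simp add: G_def)
    next
      case 2
      then have "x = 0" by (intro coord_eqI) (simp add: coord_simps)
      then show ?thesis by (simp add: G_def)
    next
      case 3
      have ge1: "1 \<le> coord v x" if v: "v \<in> U" "coord v x \<noteq> 0" for v
        using int[OF v(1)] nonneg[OF v(1)] v(2) by (auto elim!: Ints_cases)
      have split: "deg x = coord u x + (\<Sum>v\<in>U-{u}. coord v x)"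
        unfolding deg_def by (rule sum.remove[OF finite_U 3(2)])
      have "coord v x = 0" if v: "v \<in> U - {u}" for v
      proof (rule ccontr)
        assume "coord v x \<noteq> 0"
        then have "1 \<le> (\<Sum>v\<in>U-{u}. coord v x)"
          using ge1[of v] v nonneg finite_U member_le_sum[of v "U - {u}" "\<lambda>v. coord v x"] by force
        then show False using split ge1[OF 3(2,3)] 3(1) by simp
      qed
      moreover from this have "coord u x = 1"
        using split 3(1) int[OF 3(2)] ge1[OF 3(2,3)] by (auto elim!: Ints_cases)
      ultimately have "x = u" using 3(2) by (intro coord_eqI) (auto simp: coord_basis)
      then show ?thesis using 3 by (simp add: G_def)
    qed
  qed
qed

text \<open>The functional \<open>- deg\<close> exposes the origin.\<close>

lemma vertex_0: "vertex_of M (convexQ hull G) 0"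
  unfolding vertex_of_def lattice_face_def valid_ineq_def
proof (intro exI conjI ballI)
  let ?p = "\<lambda>x. - deg x"
  have lin: "linearQ ?p" by (rule rat_pair.linear_compose_neg[OF linear_deg])
  then show "?p \<in> dual_lattice M" by (rule dual_latticeI) (simp add: deg_basis)
  have le: "?p s \<le> 0" if "s \<in> G" for s using deg_G[OF that] by auto
  then show "?p x \<le> of_int 0" if "x \<in> convexQ hull G" for x using hull_le[OF lin le that] by simp
  have "{s \<in> G. ?p s = 0} = {0}" using deg_G by (auto simp: G_def split: if_splits)
  then show "{0} = {x \<in> convexQ hull G. ?p x = of_int 0}"
    using face_subset_hull[OF lin, of G 0] le by (auto simp: hull_singleton G_in deg_simps)
qed

text \<open>The functional \<open>coord u - deg\<close>, minus the sum of the other coordinates, exposes the edge in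
direction \<open>u\<close>. Conversely, if \<open>d\<close> is the direction of an edge with functional \<open>p \<le> 0\<close>, then \<open>p\<close>
vanishes at every \<open>u \<in> U\<close> that has a positive coordinate in \<open>d\<close>; so such a \<open>u\<close> lies on the edge and
is collinear with \<open>d\<close>, hence equal to \<open>d\<close> as both are primitive.\<close>

lemma edge_directions_0: "edge_directions M (convexQ hull G) 0 = U"
proof
  show "U \<subseteq> edge_directions M (convexQ hull G) 0"
  proof
    fix u assume u: "u \<in> U"
    let ?p = "\<lambda>x. coord u x - deg x"
    let ?F = "{x \<in> convexQ hull G. ?p x = of_int 0}"
    have lin: "linearQ ?p" by (rule rat_pair.linear_compose_sub[OF linear_coord linear_deg])
    have p: "?p x = - (\<Sum>v\<in>U-{u}. coord v x)" for x
      unfolding deg_def by (simp add: sum.remove[OF finite_U u])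
    have zero: "coord v x = 0" if x: "x \<in> ?F" and v: "v \<in> U - {u}" for v x
    proof -
      have sum0: "(\<Sum>v\<in>U-{u}. coord v x) = 0" using x p[of x] by simp
      have nonneg: "0 \<le> coord w x" if "w \<in> U - {u}" for w
        using that x coord_nonneg_hull by blast
      show ?thesis
        by (rule sum_nonneg_0[of "U - {u}" "\<lambda>w. coord w x", OF _ nonneg sum0 v]) (simp_all add: finite_U)
    qed
    have "valid_ineq M (convexQ hull G) ?p 0"
      unfolding valid_ineq_def
    proof (intro conjI ballI)
      show "?p \<in> dual_lattice M" using lin by (rule dual_latticeI) (simp add: deg_basis coord_basis)
      show "?p x \<le> of_int 0" if "x \<in> convexQ hull G" for x
        unfolding p using coord_nonneg_hull that by (auto intro!: sum_nonneg)
    qed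
    then have "lattice_face M (convexQ hull G) ?F" unfolding lattice_face_def by blast
    moreover have F: "0 \<in> ?F" "u \<in> ?F" using u by (auto simp: G_in coord_simps deg_simps coord_basis deg_basis)
    moreover have "aff_dimQ ?F = 1"
    proof (rule aff_dimQ_segment[OF _ F])
      show "u \<noteq> 0" using u zero_notin_U by blast
      fix y assume y: "y \<in> ?F"
      have "coord v y = 0" if "v \<in> U" "v \<noteq> u" for v
        using zero[OF y, of v] that by blast
      then have "y = 0 + coord u y *\<^sub>Q u"
        using u by (intro coord_eqI) (auto simp: coord_simps coord_basis)
      then show "\<exists>t. y = 0 + t *\<^sub>Q u" by (rule exI)
    qed
    ultimately have "edge_ofQ M (convexQ hull G) ?F" by (simp add: edge_ofQ_def)
    then show "u \<in> edge_directions M (convexQ hull G) 0"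
      unfolding edge_directions_def using F primitive_basis[OF u]
      by (intro CollectI conjI exI[of _ ?F] exI[of _ 1]) auto
  qed
  show "edge_directions M (convexQ hull G) 0 \<subseteq> U"
  proof
    fix d assume "d \<in> edge_directions M (convexQ hull G) 0"
    then obtain F k where prim: "primitive M d" and F: "edge_ofQ M (convexQ hull G) F" "0 \<in> F"
      and k: "k > 0" "k *\<^sub>Q d \<in> F" unfolding edge_directions_def by auto
    obtain p a where pa: "valid_ineq M (convexQ hull G) p a" and F_eq: "F = {x \<in> convexQ hull G. p x = of_int a}"
      using F unfolding edge_ofQ_def lattice_face_def by blast
    have lin: "linearQ p" using pa by (simp add: valid_ineq_def dual_lattice_iff)
    have a: "a = 0" using F(2) F_eq lin by (simp add: linearQ_simps)
    have le: "p u \<le> 0" if "u \<in> U" for u using pa a G_in(2)[OF that] by (auto simp: valid_ineq_def)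
    define x where "x = k *\<^sub>Q d"
    have x: "x \<in> convexQ hull G" "p x = 0" "x \<noteq> 0" using k F_eq a prim by (auto simp: x_def primitive_def)
    have "\<exists>u\<in>U. coord u x \<noteq> coord u 0" using coord_eqI[of x 0] x(3) by blast
    then obtain u where u: "u \<in> U" "coord u x \<noteq> 0" unfolding coord_simps(4) by blast
    have sum0: "(\<Sum>v\<in>U. coord v x * - p v) = 0"
      using linear_expand[OF lin, of x] unfolding x(2) scaleQ_rat_eq_times by (simp add: sum_negf)
    have nonneg: "0 \<le> coord v x * - p v" if "v \<in> U" for v
      using le[OF that] coord_nonneg_hull[OF that x(1)] by (intro mult_nonneg_nonneg) auto
    have "coord u x * - p u = 0"
      by (rule sum_nonneg_0[of U "\<lambda>v. coord v x * - p v", OF finite_U nonneg sum0 u(1)])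
    then have "p u = 0" using u(2) by simp
    then have uF: "u \<in> F" using u F_eq a by (simp add: G_in)
    have "u \<noteq> 0" using u zero_notin_U by blast
    then obtain t where "x = t *\<^sub>Q u"
      using collinear_of_aff_dimQ_1[of F 0 u x] F uF k by (auto simp: edge_ofQ_def x_def)
    moreover have "d = (1 / k) *\<^sub>Q x" using k(1) by (simp add: x_def)
    ultimately have d: "d = (t / k) *\<^sub>Q u" by simp
    \<comment> \<open>The factor \<open>t / k\<close> is an integer since \<open>d\<close> is a lattice vector, a unit since \<open>d\<close> is primitive,
      and nonnegative since the polytope has nonnegative coordinates.\<close>
    then have c: "coord u d = t / k" using u by (simp add: coord_simps coord_basis)
    moreover have "d \<in> M" using prim by (simp add: primitive_def)
    ultimately obtain m where m: "t / k = of_int m" using coord_Ints[of d u] u by (auto elim: Ints_cases)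
    have prim': "\<bar>k\<bar> = 1" if "w \<in> M" "d = scaleZ k w" for k w
      using prim that unfolding primitive_def by blast
    have "\<bar>m\<bar> = 1" by (rule prim'[OF basis_in_M[OF u(1)]]) (simp only: d m)
    moreover have "0 \<le> coord u x" using coord_nonneg_hull x u by blast
    then have "0 \<le> m" using c[unfolded m] k(1) by (simp add: x_def coord_simps zero_le_mult_iff)
    ultimately have "m = 1" by simp
    then show "d \<in> U" unfolding d m using u(1) by simp
  qed
qed

text \<open>Suppose \<open>p u < 0\<close> on a facet \<open>p = a\<close> with \<open>a > 0\<close>. The facet spans the space, so one of its generators
has a nonzero \<open>u\<close>-coordinate. It is not \<open>u\<close> itself, so it is \<open>b + c\<close> with \<open>u \<in> {b, c}\<close>; then the other
summand has value \<open>a - p u > a\<close>, although it lies in the polytope.\<close>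

lemma facet_nonneg:
  assumes facet: "facet_ineq M (convexQ hull G) p a" and p0: "p 0 \<noteq> of_int a"
    and dim: "aff_dimQ (convexQ hull G) = int (card U)" and u: "u \<in> U"
  shows "0 \<le> p u"
proof (rule ccontr)
  assume neg: "\<not> 0 \<le> p u"
  let ?F = "{x \<in> convexQ hull G. p x = of_int a}"
  have pa: "valid_ineq M (convexQ hull G) p a" and dimF: "aff_dimQ ?F = int (card U) - 1"
    using facet dim by (auto simp: facet_ineq_def)
  have lin: "linearQ p" using pa by (simp add: valid_ineq_def dual_lattice_iff)
  have le: "p x \<le> of_int a" if "x \<in> convexQ hull G" for x using pa that by (simp add: valid_ineq_def)
  have p00: "p 0 = 0" using lin by (simp add: linearQ_simps)
  then have a: "a > 0" using le[OF G_in(1)] p0 by auto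
  have ne: "?F \<noteq> {}"
  proof
    assume "?F = {}"
    then have "aff_dimQ ?F = -1" by (simp only: aff_dimQ_def simp_thms if_True)
    then show False using dimF u finite_U by (auto simp: card_eq_0_iff)
  qed
  have "rat_vector.span ?F = UNIV"
    by (rule span_facet[OF lin _ _ ne dimF, of "of_int a"]) (use a in auto)
  moreover have "rat_vector.subspace {x. coord u x = 0}"
    by (auto simp: rat_vector.subspace_def coord_simps)
  ultimately have "u \<in> {x. coord u x = 0}" if "?F \<subseteq> {x. coord u x = 0}"
    using rat_vector.span_minimal[OF that] by blast
  then have "\<not> ?F \<subseteq> {x. coord u x = 0}" using coord_basis[OF u, of u] by auto
  then obtain x where x: "x \<in> ?F" "coord u x \<noteq> 0" by blast
  have "\<exists>s\<in>G. p s = of_int a \<and> coord u s \<noteq> 0"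
  proof (rule ccontr)
    assume "\<not> ?thesis"
    then have z: "coord u s = 0" if "s \<in> {s \<in> G. p s = of_int a}" for s using that by blast
    have "x \<in> convexQ hull {s \<in> G. p s = of_int a}"
      using face_subset_hull[OF lin, of G "of_int a" x] le hull_inc[of _ G convexQ] x by blast
    then have "coord u x = 0"
      using hull_le[OF linear_coord, of "{s \<in> G. p s = of_int a}" u 0 x]
        hull_ge[OF linear_coord, of "{s \<in> G. p s = of_int a}" 0 u x] z by force
    then show False using x by simp
  qed
  then obtain s where s: "s \<in> G" "p s = of_int a" "coord u s \<noteq> 0" by blast
  have "s \<noteq> 0" using s by (auto simp: coord_simps)
  moreover have "s \<notin> U" using s u coord_basis[of s u] neg a by (auto split: if_splits)
  ultimately have "s = b + c" using s by (auto simp: G_def)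
  then have "p b + p c = of_int a" "u = b \<or> u = c"
    using s bc u lin by (auto simp: linearQ_simps coord_simps coord_basis split: if_splits)
  then show False using le[OF G_in(2)[OF bc(1)]] le[OF G_in(2)[OF bc(2)]] neg by auto
qed

lemma hull_inscribed: "convexQ hull G \<in> inscribed_polytopes M (card U + 2)"
proof -
  have "finite G" using finite_U by (simp add: G_def)
  have card: "card G = card U + 2" using sum_notin zero_notin_U finite_U by (simp add: G_def)
  have "lattice_polytope M (convexQ hull G)"
    unfolding lattice_polytope_def using \<open>finite G\<close> lattice_points by blast
  moreover have dim: "aff_dimQ (convexQ hull G) = int (card U)"
  proof -
    let ?D = "{x - y |x y. x \<in> convexQ hull G \<and> y \<in> convexQ hull G}"
    have "U \<subseteq> ?D" using G_in by (force intro: diff_0_right[symmetric])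
    then have "rat_vector.span ?D = UNIV" using rat_vector.span_mono span_U by blast
    then have "rat_vector.dim ?D = card U" by (simp only: fd.dim_eq_full[unfolded fd.dimension_def])
    then show ?thesis using G_in by (auto simp: aff_dimQ_def)
  qed
  moreover have "inscribed_in_rectangle M (convexQ hull G)"
    unfolding inscribed_in_rectangle_def
    using vertex_0 edge_directions_0 basis facet_nonneg[OF _ _ dim] by (intro exI[of _ 0]) auto
  ultimately show ?thesis
    using \<open>finite G\<close> card
    by (simp add: inscribed_polytopes_def full_dimensional_def aff_dimQ_UNIV lattice_points)
qed

end

section \<open>Inscribed polytopes with one lattice point beyond the vertex and the edges\<close>

text \<open>The edge in direction \<open>u\<close> is the hull of its lattice points, so it contains a lattice point
\<open>v0 + m u\<close> with an integer \<open>m \<ge> 1\<close>, and then \<open>v0 + u\<close> lies between this point and \<open>v0\<close>.\<close>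

lemma edge_direction_in:
  assumes P: "lattice_polytope M P" and v0: "v0 \<in> M" "v0 \<in> P"
    and u: "u \<in> edge_directions M P v0" "u \<in> U"
  shows "v0 + u \<in> P"
proof -
  obtain F c where F: "edge_ofQ M P F" "v0 \<in> F" and c: "c > 0" "v0 + c *\<^sub>Q u \<in> F"
    using u(1) by (auto simp: edge_directions_def)
  obtain p a where pa: "valid_ineq M P p a" and F_eq: "F = {x \<in> P. p x = of_int a}"
    using F unfolding edge_ofQ_def lattice_face_def by blast
  have lin: "linearQ p" using pa by (simp add: valid_ineq_def dual_lattice_iff)
  let ?S = "{s \<in> P \<inter> M. p s = of_int a}"
  have "v0 + c *\<^sub>Q u \<in> convexQ hull ?S"
    using face_subset_hull[OF lin, of "P \<inter> M" "of_int a"] pa c(2) F_eq hull_lattice_points[OF P]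
    by (auto simp: valid_ineq_def)
  then have "\<exists>s\<in>?S. coord u v0 < coord u s"
    using hull_le[OF linear_coord, of ?S u "coord u v0" "v0 + c *\<^sub>Q u"] c(1) u(2)
    by (force simp: coord_simps coord_basis)
  then obtain s where s: "s \<in> P" "s \<in> M" "p s = of_int a" "coord u v0 < coord u s" by blast
  have "c *\<^sub>Q u \<noteq> 0" using c u zero_notin_U by auto
  then obtain t where "s - v0 = t *\<^sub>Q c *\<^sub>Q u"
    using collinear_of_aff_dimQ_1[of F v0 "v0 + c *\<^sub>Q u" s] F c s by (auto simp: edge_ofQ_def F_eq)
  then have tc: "s = v0 + (t * c) *\<^sub>Q u" by (metis diff_add_cancel add.commute scaleQ_scaleQ)
  then have coord: "coord u s = coord u v0 + t * c" using u by (simp add: coord_simps coord_basis)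
  have "coord u s - coord u v0 \<in> \<int>" using coord_Ints s v0 u by auto
  then obtain m where m: "t * c = of_int m" using coord by (auto elim: Ints_cases)
  then have "m \<ge> 1" using s(4) coord by simp
  then have m1: "1 / of_int m \<le> (1::rat)" "(0::rat) < of_int m" by simp_all
  have "v0 + u = (1 - 1 / of_int m) *\<^sub>Q v0 + (1 / of_int m) *\<^sub>Q s"
    using m1 by (simp add: tc m scaleQ_add_right rat_vector.scale_left_diff_distrib)
  also have "\<dots> \<in> convexQ hull (P \<inter> M)"
    using m1 s(1) v0 hull_lattice_points[OF P] by (intro convexQD[OF convexQ_convexQ_hull]) auto
  finally show ?thesis using hull_lattice_points[OF P] by simp
qed

text \<open>The situation after the lattice points have been counted: \<open>v0 + w\<close> is the one lattice point besides
\<open>v0\<close> and the points \<open>v0 + u\<close>. The form of \<open>w\<close> is to be determined.\<close>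

context
  fixes P v0 w
  assumes vertex: "vertex_of M P v0" and edges: "edge_directions M P v0 = U"
    and full: "aff_dimQ P = int (card U)"
    and facets: "\<And>p a u. facet_ineq M P p a \<Longrightarrow> p v0 \<noteq> of_int a \<Longrightarrow> u \<in> U \<Longrightarrow> 0 \<le> p u"
    and v0: "v0 \<in> M" and w: "w \<in> M" "w \<noteq> 0" "w \<notin> U"
    and P: "P = (\<lambda>x. v0 + x) ` (convexQ hull (insert 0 (insert w U)))"
    and lattice: "P \<inter> M = (\<lambda>x. v0 + x) ` (insert 0 (insert w U))"
begin

lemma valid_ineq_shift:
  assumes p: "linearQ p" "\<And>u. u \<in> U \<Longrightarrow> p u \<in> \<int>"
    and le: "\<And>u. u \<in> U \<Longrightarrow> p u \<le> of_int a" "p w \<le> of_int a" "0 \<le> a"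
  shows "\<exists>a'. of_int a' = p v0 + of_int a \<and> valid_ineq M P p a'"
proof -
  have dual: "p \<in> dual_lattice M" using p by (rule dual_latticeI)
  then obtain m where m: "p v0 = of_int m" using v0 by (auto simp: dual_lattice_iff elim: Ints_cases)
  have "p x \<le> of_int a" if "x \<in> convexQ hull (insert 0 (insert w U))" for x
    by (rule hull_le[OF p(1) _ that]) (use le p(1) in \<open>auto simp: linearQ_simps\<close>)
  then have "valid_ineq M P p (m + a)" using dual m p(1) by (auto simp: valid_ineq_def P linearQ_simps)
  then show ?thesis using m by (intro exI[of _ "m + a"]) simp
qed

text \<open>If \<open>w\<close> had a negative coordinate, it would also have a positive one, since a functional that exposes
\<open>v0\<close> is negative on \<open>U\<close> and at \<open>w\<close>. Then there is a functional that vanishes at \<open>w\<close> and is negative on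
\<open>U\<close>, and so \<open>w\<close> spans an edge at \<open>v0\<close>. Its primitive direction is a positive multiple of \<open>w\<close> and
belongs to \<open>U\<close>, contrary to the negative coordinate.\<close>

lemma coord_w_nonneg:
  assumes "u \<in> U"
  shows "0 \<le> coord u w"
proof (rule ccontr)
  assume "\<not> 0 \<le> coord u w"
  then have neg: "coord u w < 0" by simp
  obtain p0 a0 where p0: "valid_ineq M P p0 a0" "{v0} = {x \<in> P. p0 x = of_int a0}"
    using vertex by (auto simp: vertex_of_def lattice_face_def)
  have lin0: "linearQ p0" using p0 by (simp add: valid_ineq_def dual_lattice_iff)
  have p0_neg: "p0 x < 0" if "v0 + x \<in> P" "x \<noteq> 0" for x
  proof -
    have "p0 v0 = of_int a0" using p0(2) by blast
    moreover have "p0 (v0 + x) \<noteq> of_int a0" using p0(2) that by (metis (mono_tags, lifting) add.right_neutral add_left_cancel mem_Collect_eq singletonD)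
    moreover have "p0 (v0 + x) \<le> of_int a0" using p0(1) that by (simp add: valid_ineq_def)
    ultimately show ?thesis using lin0 by (simp add: linearQ_simps)
  qed
  have in_P: "v0 + x \<in> P" if "x \<in> insert 0 (insert w U)" for x
    using that lattice by blast
  have "\<exists>v\<in>U. 0 < coord v w"
  proof (rule ccontr)
    assume "\<not> ?thesis"
    moreover have "p0 v < 0" if "v \<in> U" for v
      using that zero_notin_U by (intro p0_neg[OF in_P]) auto
    ultimately have "0 \<le> coord v w * p0 v" if "v \<in> U" for v
      using that by (intro mult_nonpos_nonpos) (auto simp: not_less less_imp_le)
    then have "0 \<le> p0 w"
      unfolding linear_expand[OF lin0, of w] scaleQ_rat_eq_times by (rule sum_nonneg)
    then show False using p0_neg[OF in_P, of w] w by simp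
  qed
  then obtain v where v: "v \<in> U" "0 < coord v w" by blast
  \<comment> \<open>Weighting the positive coordinates by the total of the negative ones and vice versa makes the
    two parts of \<open>p w\<close> cancel.\<close>
  define N where "N = (\<Sum>v\<in>U. max (- coord v w) 0)"
  define Q where "Q = (\<Sum>v\<in>U. max (coord v w) 0)"
  have "0 < N" unfolding N_def using finite_U assms neg by (intro sum_pos2[of _ u]) auto
  have "0 < Q" unfolding Q_def using finite_U v by (intro sum_pos2[of _ v]) auto
  have "N \<in> \<int>" "Q \<in> \<int>" unfolding N_def Q_def using coord_Ints[OF w(1)] by (auto intro!: Ints_sum simp: max_def)
  define f where "f v = - (if 0 < coord v w then N else if coord v w < 0 then Q else 1)" for v
  obtain p :: "'a \<Rightarrow> rat" where p: "linearQ p" "\<And>u. u \<in> U \<Longrightarrow> p u = f u" using linear_extension[of f] by metis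
  have f_neg: "f v < 0" for v using \<open>0 < N\<close> \<open>0 < Q\<close> by (simp add: f_def)
  have "p w = (\<Sum>u\<in>U. max (- coord u w) 0 * Q - max (coord u w) 0 * N)"
    unfolding linear_expand[OF p(1), of w] scaleQ_rat_eq_times
    by (rule sum.cong) (auto simp: p(2) f_def max_def)
  also have "\<dots> = 0" by (simp add: sum_subtractf N_def Q_def mult.commute flip: sum_distrib_right)
  finally have pw: "p w = 0" .
  have "f v \<in> \<int>" for v using \<open>N \<in> \<int>\<close> \<open>Q \<in> \<int>\<close> by (simp add: f_def)
  then have "\<exists>a. of_int a = p v0 + of_int 0 \<and> valid_ineq M P p a"
    using p(2) f_neg pw by (intro valid_ineq_shift p(1)) (simp_all add: less_imp_le)
  then obtain a where a: "of_int a = p v0" "valid_ineq M P p a" by auto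
  have p_zero: "p 0 = 0" using p(1) by (simp add: linearQ_simps)
  have p_neg: "p u \<noteq> 0" "p u \<le> 0" if "u \<in> U" for u using f_neg[of u] p(2)[OF that] by auto
  let ?F = "{x \<in> P. p x = of_int a}"
  have F: "v0 \<in> ?F" "v0 + w \<in> ?F"
    using a(1) pw p(1) in_P[of 0] in_P[of w] by (simp_all add: linearQ_simps)
  have "aff_dimQ ?F = 1"
  proof (rule aff_dimQ_segment[OF _ F])
    show "v0 + w \<noteq> v0" using w by simp
    fix y assume "y \<in> ?F"
    then obtain x where x: "y = v0 + x" "x \<in> convexQ hull (insert 0 (insert w U))" "p x = 0"
      using a(1) p(1) by (auto simp: P linearQ_simps)
    have "x \<in> convexQ hull {s \<in> insert 0 (insert w U). p s = 0}"
      by (rule face_subset_hull[OF p(1) _ x(2,3)])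
        (use pw p_zero p_neg in \<open>auto simp: less_imp_le\<close>)
    also have "{s \<in> insert 0 (insert w U). p s = 0} = {0, w}"
      using pw p_zero p_neg by auto
    also have "convexQ hull {0, w} \<subseteq> rat_vector.span {0, w}" by (rule hull_subset_span)
    finally show "\<exists>t. y = v0 + t *\<^sub>Q w" using x(1) by (auto simp: rat_vector.span_insert_0 rat_vector.span_singleton)
  qed
  then have edge: "edge_ofQ M P ?F" using a(2) unfolding edge_ofQ_def lattice_face_def by blast
  obtain k d where d: "0 < k" "primitive M d" "w = scaleZ k d" using primitive_multiple[OF w(1,2)] by blast
  have "d \<in> edge_directions M P v0"
    unfolding edge_directions_def using edge F d
    by (intro CollectI conjI exI[of _ ?F] exI[of _ "of_int k"]) simp_all
  then have "0 \<le> coord u d" using edges assms by (auto simp: coord_basis)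
  then show False using neg d by (simp add: coord_simps mult_less_0_iff)
qed

text \<open>The functional with value \<open>coord k w\<close> on \<open>U - {k}\<close> and at \<open>w\<close> is a facet normal: since
\<open>coord k w \<ge> 1\<close>, its value \<open>1 - (deg w - coord k w)\<close> at \<open>k\<close> does not exceed \<open>coord k w\<close>. The rectangle
condition for this facet is the claim.\<close>

lemma coord_sum_others_le_1:
  assumes k: "k \<in> U" "0 < coord k w"
  shows "deg w - coord k w \<le> 1"
proof -
  define A where "A = coord k w"
  have split: "deg w = A + (\<Sum>v\<in>U-{k}. coord v w)"
    unfolding deg_def A_def by (rule sum.remove[OF finite_U k(1)])
  have others: "0 \<le> (\<Sum>v\<in>U-{k}. coord v w)" by (intro sum_nonneg) (simp add: coord_w_nonneg)
  obtain m where m: "A = of_int m" using coord_Ints[OF w(1) k(1)] by (auto simp: A_def elim: Ints_cases)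
  have m1: "1 \<le> m" using k(2) m by (simp add: A_def)
  have deg_int: "deg w \<in> \<int>" unfolding deg_def using coord_Ints w(1) by (intro Ints_sum)
  \<comment> \<open>The factor \<open>coord k w\<close> clears the denominator of the normal with right-hand side 1.\<close>
  define f where "f v = (if v = k then 1 - (deg w - A) else A)" for v
  obtain p :: "'a \<Rightarrow> rat" where p: "linearQ p" "\<And>u. u \<in> U \<Longrightarrow> p u = f u" using linear_extension[of f] by metis
  have "p w = A * (1 - (deg w - A)) + (\<Sum>v\<in>U-{k}. coord v w * A)"
    unfolding linear_expand[OF p(1), of w] scaleQ_rat_eq_times sum.remove[OF finite_U k(1)]
    by (intro arg_cong2[where f = "(+)"] sum.cong) (auto simp: p(2) k f_def A_def)
  also have "\<dots> = A" unfolding split by (simp add: algebra_simps flip: sum_distrib_left)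
  finally have pw: "p w = A" .
  have "f v \<in> \<int>" "f v \<le> A" for v using m m1 deg_int split others by (auto simp: f_def)
  then have "\<exists>a. of_int a = p v0 + of_int m \<and> valid_ineq M P p a"
    using p(2) pw m m1 by (intro valid_ineq_shift p(1)) simp_all
  then obtain a where a: "of_int a = p v0 + of_int m" "valid_ineq M P p a" by blast
  let ?F = "{x \<in> P. p x = of_int a}"
  have F: "v0 + w \<in> ?F" "\<And>u. u \<in> U \<Longrightarrow> u \<noteq> k \<Longrightarrow> v0 + u \<in> ?F"
    using a(1) pw p m lattice by (auto simp: linearQ_simps f_def)
  let ?W = "insert w {x - y |x y. x \<in> ?F \<and> y \<in> ?F}"
  have "aff_dimQ ?F = int (card U) - 1"
  proof (rule aff_dimQ_hyperplane_section[OF p(1)])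
    show "p w \<noteq> 0" using pw k by (simp add: A_def)
    have other: "u \<in> rat_vector.span ?W" if "u \<in> U" "u \<noteq> k" for u
    proof -
      have "u = ((v0 + u) - (v0 + w)) + w" by simp
      also have "\<dots> \<in> rat_vector.span ?W"
        using F that by (intro rat_vector.span_add rat_vector.span_base) blast+
      finally show ?thesis .
    qed
    have "w = A *\<^sub>Q k + (\<Sum>v\<in>U-{k}. coord v w *\<^sub>Q v)"
      using sum_coord[of w] sum.remove[OF finite_U k(1), of "\<lambda>v. coord v w *\<^sub>Q v"] by (simp add: A_def)
    then have "A *\<^sub>Q k = w - (\<Sum>v\<in>U-{k}. coord v w *\<^sub>Q v)" by (simp add: eq_diff_eq)
    also have "\<dots> \<in> rat_vector.span ?W"
      using other by (intro rat_vector.span_diff rat_vector.span_sum rat_vector.span_scale)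
        (auto intro: rat_vector.span_base)
    finally have "(1 / A) *\<^sub>Q A *\<^sub>Q k \<in> rat_vector.span ?W" by (rule rat_vector.span_scale)
    then have "k \<in> rat_vector.span ?W" using k by (simp add: A_def)
    then show "U \<subseteq> rat_vector.span ?W" using other by blast
  qed (use F in auto)
  then have "facet_ineq M P p a" using a(2) full by (simp add: facet_ineq_def)
  moreover have "p v0 \<noteq> of_int a" using a(1) m1 by simp
  ultimately have "0 \<le> p k" using facets k by blast
  then show ?thesis using p(2) k by (simp add: f_def A_def)
qed

text \<open>Let \<open>k\<close> have a positive coordinate. The other coordinates add up to 0 or 1. If they vanish,
\<open>w = m k\<close> with \<open>m \<ge> 2\<close>, and \<open>2 k\<close> is a lattice point of the hull, which forces \<open>m = 2\<close>. Otherwise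
exactly one other coordinate is 1, and the same bound for that index makes the coordinate of \<open>k\<close>
equal to 1.\<close>

lemma extra_point: "\<exists>b\<in>U. \<exists>c\<in>U. w = b + c"
proof -
  have int: "coord v w \<in> \<int>" if "v \<in> U" for v using coord_Ints w(1) that by blast
  have "\<exists>u\<in>U. coord u w \<noteq> coord u 0" using coord_eqI[of w 0] w(2) by blast
  then obtain k where k: "k \<in> U" "0 < coord k w"
    unfolding coord_simps(4) using coord_w_nonneg by force
  have split: "deg w = coord k w + (\<Sum>v\<in>U-{k}. coord v w)"
    unfolding deg_def by (rule sum.remove[OF finite_U k(1)])
  have nonneg: "0 \<le> coord v w" if "v \<in> U - A" for v A using that coord_w_nonneg by blast
  show ?thesis
  proof (cases "\<exists>l\<in>U-{k}. coord l w \<noteq> 0")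
    case False
    then have wk: "w = coord k w *\<^sub>Q k" using k by (intro coord_eqI) (auto simp: coord_simps coord_basis)
    obtain m where m: "coord k w = of_int m" using int[OF k(1)] by (auto elim: Ints_cases)
    have "m \<noteq> 1" using wk m w(3) k(1) by auto
    then have m2: "2 \<le> m" using k(2) m by simp
    have "(1 - 2 / of_int m) *\<^sub>Q 0 + (2 / of_int m) *\<^sub>Q w \<in> convexQ hull (insert 0 (insert w U))"
      using m2 by (intro convexQD[OF convexQ_convexQ_hull] hull_inc) auto
    also have "(1 - 2 / of_int m) *\<^sub>Q 0 + (2 / of_int m) *\<^sub>Q w = (2 / of_int m) *\<^sub>Q of_int m *\<^sub>Q k"
      using wk m by simp
    also have "\<dots> = 2 *\<^sub>Q k" using m2 by simp
    finally have "v0 + 2 *\<^sub>Q k \<in> P" using P by blast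
    moreover have "v0 + 2 *\<^sub>Q k \<in> M"
      using v0 k M_closed(4)[of k 2] by (auto intro: M_closed(2) basis_in_M)
    ultimately have "v0 + 2 *\<^sub>Q k \<in> (\<lambda>x. v0 + x) ` (insert 0 (insert w U))"
      unfolding lattice[symmetric] by blast
    then have "2 *\<^sub>Q k \<in> insert 0 (insert w U)" by auto
    moreover have "deg (2 *\<^sub>Q k) = 2" using k by (simp add: deg_simps deg_basis)
    ultimately have "2 *\<^sub>Q k = w" using deg_basis[of "2 *\<^sub>Q k"] by (auto simp: deg_simps)
    moreover have "2 *\<^sub>Q k = k + k" using scaleQ_add_left[of 1 1 k] by simp
    ultimately show ?thesis using k by metis
  next
    case True
    then obtain l where l: "l \<in> U - {k}" "coord l w \<noteq> 0" by blast
    have ge1: "1 \<le> coord v w" if v: "v \<in> U" "coord v w \<noteq> 0" for v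
      using int[OF v(1)] coord_w_nonneg[OF v(1)] v(2) by (auto elim!: Ints_cases)
    have split2: "(\<Sum>v\<in>U-{k}. coord v w) = coord l w + (\<Sum>v\<in>U-{k}-{l}. coord v w)"
      by (rule sum.remove) (use l finite_U in auto)
    have rest: "0 \<le> (\<Sum>v\<in>U-{k}-{l}. coord v w)" by (intro sum_nonneg) (simp add: coord_w_nonneg)
    have "deg w - coord k w \<le> 1" "deg w - coord l w \<le> 1"
      using coord_sum_others_le_1[OF k] coord_sum_others_le_1[of l] l ge1[of l] by auto
    then have one: "coord k w = 1" "coord l w = 1" and "(\<Sum>v\<in>U-{k}-{l}. coord v w) = 0"
      using split split2 rest ge1[of k] ge1[of l] k l by auto
    then have zero: "coord v w = 0" if "v \<in> U - {k} - {l}" for v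
      using sum_nonneg_0[of "U - {k} - {l}" "\<lambda>v. coord v w" v] that finite_U coord_w_nonneg by auto
    have "w = k + l"
    proof (rule coord_eqI)
      fix v assume "v \<in> U"
      then show "coord v w = coord v (k + l)"
        using one zero[of v] k l by (cases "v = k"; cases "v = l") (auto simp: coord_simps coord_basis)
    qed
    then show ?thesis using k l by blast
  qed
qed

end

text \<open>A vertex of a lattice polytope is a lattice point, because as a face it is the hull of the lattice
points on it. Counting then leaves a single lattice point besides \<open>v0\<close> and the points \<open>v0 + u\<close>.\<close>

lemma translated_hull_of_inscribed:
  assumes P: "lattice_polytope M P" "aff_dimQ P = int (card U)"
    and vertex: "vertex_of M P v0" and edges: "edge_directions M P v0 = U"
    and facets: "\<And>p a u. facet_ineq M P p a \<Longrightarrow> p v0 \<noteq> of_int a \<Longrightarrow> u \<in> U \<Longrightarrow> 0 \<le> p u"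
    and card: "finite (P \<inter> M)" "card (P \<inter> M) = card U + 2"
  shows "v0 \<in> M \<and> (\<exists>b\<in>U. \<exists>c\<in>U. P = (\<lambda>x. v0 + x) ` (convexQ hull (insert 0 (insert (b + c) U))))"
proof -
  obtain p a where pa: "valid_ineq M P p a" "{v0} = {x \<in> P. p x = of_int a}"
    using vertex by (auto simp: vertex_of_def lattice_face_def)
  have lin: "linearQ p" using pa by (simp add: valid_ineq_def dual_lattice_iff)
  have v0P: "v0 \<in> P" using pa(2) by blast
  have v0M: "v0 \<in> M"
  proof (rule ccontr)
    assume "v0 \<notin> M"
    have "v0 \<in> convexQ hull {s \<in> P \<inter> M. p s = of_int a}"
      using face_subset_hull[OF lin, of "P \<inter> M" "of_int a" v0] pa hull_lattice_points[OF P(1)]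
      by (auto simp: valid_ineq_def)
    also have "{s \<in> P \<inter> M. p s = of_int a} = {}"
    proof -
      have "s \<in> {v0}" if "s \<in> P" "p s = of_int a" for s using that unfolding pa(2) by simp
      then show ?thesis using \<open>v0 \<notin> M\<close> by blast
    qed
    also have "convexQ hull {} = {}" by (rule hull_unique) (auto simp: convexQ_def)
    finally show False by simp
  qed
  let ?A = "insert v0 ((\<lambda>x. v0 + x) ` U)"
  have "?A \<subseteq> P \<inter> M"
    using v0P v0M edge_direction_in[OF P(1) v0M v0P] edges by (auto intro: M_closed basis_in_M)
  moreover have cardA: "card ?A = card U + 1"
  proof -
    have "v0 \<notin> (\<lambda>x. v0 + x) ` U" using zero_notin_U by auto
    then show ?thesis using finite_U by (simp add: card_image)
  qed
  ultimately have "card (P \<inter> M - ?A) = 1" using card finite_U by (subst card_Diff_subset) auto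
  then obtain z where z: "P \<inter> M - ?A = {z}" by (rule card_1_singletonE)
  define w where "w = z - v0"
  have zw: "z = v0 + w" by (simp add: w_def)
  have lattice: "P \<inter> M = (\<lambda>x. v0 + x) ` (insert 0 (insert w U))"
    using z \<open>?A \<subseteq> P \<inter> M\<close> zw by auto
  have "z \<in> M" "v0 + w \<notin> ?A" using z zw by blast+
  moreover have "w \<in> M" unfolding w_def using \<open>z \<in> M\<close> v0M by (rule M_closed)
  ultimately have w: "w \<in> M" "w \<noteq> 0" "w \<notin> U" by auto
  have "P = (\<lambda>x. v0 + x) ` (convexQ hull (insert 0 (insert w U)))"
    unfolding hull_translation lattice[symmetric] by (rule hull_lattice_points[OF P(1)])
  moreover have "\<exists>b\<in>U. \<exists>c\<in>U. w = b + c"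
    by (rule extra_point[OF vertex edges P(2) _ v0M w calculation lattice]) (rule facets)
  ultimately show ?thesis using v0M by blast
qed

section \<open>Equivalence of the polytopes obtained\<close>

text \<open>The two bases have the same size and \<open>b = c \<longleftrightarrow> b' = c'\<close>, so some bijection between them sends \<open>b\<close> to
\<open>b'\<close> and \<open>c\<close> to \<open>c'\<close>; its linear extension is the change of basis.\<close>

lemma lattice_equivalent_translated_hull:
  assumes U': "lattice_coordinates M U'" and card: "card U = card U'"
    and bc: "b \<in> U" "c \<in> U" "b' \<in> U'" "c' \<in> U'" "b = c \<longleftrightarrow> b' = c'" and t: "t \<in> M"
  shows "lattice_equivalent M (convexQ hull (insert 0 (insert (b + c) U)))
    ((\<lambda>x. t + x) ` (convexQ hull (insert 0 (insert (b' + c') U'))))"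
proof -
  interpret U': lattice_coordinates M U' by (rule U')
  have "card {b, c} = card {b', c'}" using bc(5) by (auto simp: card_insert_if)
  then have "card (U - {b, c}) = card (U' - {b', c'})"
    using card bc finite_U U'.finite_U by (simp add: card_Diff_subset)
  then obtain f where f: "bij_betw f (U - {b, c}) (U' - {b', c'})"
    using finite_same_card_bij finite_U U'.finite_U by (metis finite_Diff)
  define h where "h x = (if x = b then b' else if x = c then c' else f x)" for x
  have "bij_betw h (U - {b, c}) (U' - {b', c'})"
    using f by (rule bij_betw_cong[THEN iffD1, rotated]) (auto simp: h_def)
  moreover have "bij_betw h {b, c} {b', c'}" using bc(5) by (auto simp: bij_betw_def inj_on_def h_def)
  ultimately have "bij_betw h ((U - {b, c}) \<union> {b, c}) ((U' - {b', c'}) \<union> {b', c'})"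
    by (rule bij_betw_combine) auto
  moreover have "(U - {b, c}) \<union> {b, c} = U" "(U' - {b', c'}) \<union> {b', c'} = U'" using bc by auto
  ultimately have h: "bij_betw h U U'" by (simp only:)
  obtain g :: "'a \<Rightarrow> 'a" where g: "linearQ g" "\<And>u. u \<in> U \<Longrightarrow> g u = h u"
    using linear_extension[of h] by metis
  obtain g' :: "'a \<Rightarrow> 'a" where g': "linearQ g'" "\<And>u. u \<in> U' \<Longrightarrow> g' u = inv_into U h u"
    using U'.linear_extension[of "inv_into U h"] by metis
  have inv1: "g' (g x) = x" for x
  proof -
    have "g' (g u) = u" if "u \<in> U" for u
      using that h g(2) g'(2) by (auto simp: bij_betw_def)
    then show ?thesis
      using rat_pair.linear_eq_on[OF Vector_Spaces.linear_compose[OF g(1) g'(1)] rat_vector.linear_id, of x U]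
      by (simp add: span_U)
  qed
  have inv2: "g (g' x) = x" for x
  proof -
    have "g (g' u) = u" if "u \<in> U'" for u
      using that h g(2) g'(2) by (auto simp: bij_betw_def f_inv_into_f inv_into_into)
    then show ?thesis
      using rat_pair.linear_eq_on[OF Vector_Spaces.linear_compose[OF g'(1) g(1)] rat_vector.linear_id, of x U']
      by (simp add: U'.span_U)
  qed
  have "h u \<in> M" if "u \<in> U" for u using that h U'.basis_in_M by (auto simp: bij_betw_def)
  then have gM: "g x \<in> M" if "x \<in> M" for x
    using linear_maps_lattice[OF g(1) _ that] g(2) by simp
  have "inv_into U h u \<in> M" if "u \<in> U'" for u
    using that h basis_in_M inv_into_into[of u h U] by (auto simp: bij_betw_def)
  then have g'M: "g' x \<in> M" if "x \<in> M" for x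
    using U'.linear_maps_lattice[OF g'(1) _ that] g'(2) by simp
  have "bij_betw g M M"
    by (rule bij_betw_byWitness[of M g' g M]) (use inv1 inv2 gM g'M in auto)
  moreover have "(\<lambda>x. t + x) ` (convexQ hull (insert 0 (insert (b' + c') U'))) =
      (\<lambda>x. t + g x) ` (convexQ hull (insert 0 (insert (b + c) U)))"
  proof -
    have "g ` U = U'" using h g(2) by (simp add: bij_betw_def cong: image_cong)
    moreover have "g (b + c) = b' + c'" using g bc by (auto simp: linear_rules h_def)
    ultimately have "g ` (insert 0 (insert (b + c) U)) = insert 0 (insert (b' + c') U')"
      using g(1) by (simp add: linearQ_simps)
    then show ?thesis
      unfolding hull_affine_image[OF g(1)] hull_translation by (metis image_image)
  qed
  ultimately show ?thesis using g(1) t unfolding lattice_equivalent_def by blast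
qed

text \<open>An equivalence would produce two points in the hull that differ by \<open>2 g d\<close>. All coordinates there
lie between 0 and 1, so the even integers that are the coordinates of \<open>2 g d\<close> vanish.\<close>

lemma not_lattice_equivalent:
  assumes bc: "b \<in> U" "c \<in> U" "b \<noteq> c" and d: "d \<in> M" "d \<noteq> 0" and P: "0 \<in> P" "d + d \<in> P"
  shows "\<not> lattice_equivalent M P (convexQ hull (insert 0 (insert (b + c) U)))"
proof
  let ?B = "convexQ hull (insert 0 (insert (b + c) U))"
  assume "lattice_equivalent M P ?B"
  then obtain g t where g: "linearQ g" "bij_betw g M M" and B: "?B = (\<lambda>x. t + g x) ` P"
    by (auto simp: lattice_equivalent_def)
  have tB: "t + g 0 \<in> ?B" "t + g (d + d) \<in> ?B" unfolding B using P by blast+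
  have gd: "g d \<in> M" using g(2) d by (auto simp: bij_betw_def)
  have "coord u (g d) = coord u 0" if u: "u \<in> U" for u
  proof -
    obtain m where m: "coord u (g d) = of_int m" using coord_Ints[OF gd u] by (auto elim: Ints_cases)
    have "0 \<le> coord u t" "coord u t \<le> 1"
      "0 \<le> coord u t + 2 * coord u (g d)" "coord u t + 2 * coord u (g d) \<le> 1"
      using coord_nonneg_hull[OF bc(1,2) u] coord_le_1[OF bc u] tB g(1)
      by (fastforce simp: linear_rules coord_simps)+
    then have "m = 0" using m by linarith
    then show ?thesis using m by (simp add: coord_simps)
  qed
  then have "g d = g 0" using coord_eqI[of "g d" 0] g(1) by (simp add: linear_rules)
  then show False using g(2) d M_closed(1) by (auto simp: bij_betw_def inj_on_def)
qed

end

section \<open>The classification\<close>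

text \<open>The edge directions at the distinguished vertex are a second basis of the lattice, of the same
cardinality as the given one because both are bases of the rational vector space.\<close>

lemma inscribed_polytopes_classification:
  assumes E: "lattice_coordinates M E" and P: "P \<in> inscribed_polytopes M (card E + 2)"
  obtains v0 U b c where "v0 \<in> M" "lattice_coordinates M U" "card E = card U" "b \<in> U" "c \<in> U"
    "P = (\<lambda>x. v0 + x) ` (convexQ hull (insert 0 (insert (b + c) U)))"
proof -
  interpret E: lattice_coordinates M E by (rule E)
  obtain v0 where P': "lattice_polytope M P" "full_dimensional P" "finite (P \<inter> M)" "card (P \<inter> M) = card E + 2"
    and vertex: "vertex_of M P v0" and basis: "lattice_basis M (edge_directions M P v0)"
    and facets: "\<forall>p a. facet_ineq M P p a \<and> p v0 \<noteq> of_int a \<longrightarrow> (\<forall>u\<in>edge_directions M P v0. 0 \<le> p u)"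
    using P by (auto simp: inscribed_polytopes_def inscribed_in_rectangle_def)
  define U where "U = edge_directions M P v0"
  have "finite U" unfolding U_def
    by (rule E.fd.finiteI_independent[OF lattice_basis_independentQ[OF basis]])
  then have U: "lattice_coordinates M U"
    using basis E.span_M by (simp add: lattice_coordinates_def U_def)
  then interpret U: lattice_coordinates M U .
  have card: "card E = card U" using E.aff_dimQ_UNIV U.aff_dimQ_UNIV by simp
  have "v0 \<in> M \<and> (\<exists>b\<in>U. \<exists>c\<in>U. P = (\<lambda>x. v0 + x) ` (convexQ hull (insert 0 (insert (b + c) U))))"
    by (rule U.translated_hull_of_inscribed[OF P'(1) _ vertex U_def[symmetric] _ P'(3)])
      (use P'(2,4) card facets U.aff_dimQ_UNIV in \<open>auto simp: full_dimensional_def U_def\<close>)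
  then show ?thesis using that U card by blast
qed

text \<open>The basis vector \<open>e 1\<close> is the midpoint of 0 and its double, so adding it to the generators does not
change the hull.\<close>

lemma polytope_A_eq:
  assumes "1 \<le> n"
  shows "polytope_A n e = convexQ hull (insert 0 (insert (e 1 + e 1) (e ` {1..n})))"
proof -
  let ?S = "{0, 2 *\<^sub>Q e 1} \<union> e ` {2..n}"
  have two: "2 *\<^sub>Q e 1 = e 1 + e 1" using scaleQ_add_left[of 1 1 "e 1"] by simp
  have "(1/2) *\<^sub>Q 0 + (1/2) *\<^sub>Q 2 *\<^sub>Q e 1 \<in> convexQ hull ?S"
    by (intro convexQD[OF convexQ_convexQ_hull] hull_inc) auto
  then have "e 1 \<in> convexQ hull ?S" by simp
  then have "convexQ hull (insert (e 1) ?S) = convexQ hull ?S" by (rule hull_redundant)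
  moreover have "insert (e 1) ?S = insert 0 (insert (e 1 + e 1) (e ` {1..n}))"
  proof -
    have "{1..n} = insert 1 {2..n}" using assms by auto
    then show ?thesis unfolding two by auto
  qed
  ultimately show ?thesis by (simp add: polytope_A_def)
qed

lemma polytope_B_eq: "polytope_B n e = convexQ hull (insert 0 (insert (e 1 + e 2) (e ` {1..n})))"
  by (simp add: polytope_B_def insert_commute)

theorem proposition1:
  fixes M :: "'a::rat_vector set" and n :: nat and e :: "nat \<Rightarrow> 'a"
  assumes "lattice_of_rank M n"
    and "n \<ge> 2"
    and "lattice_basis_seq M n e"
  shows "polytope_A n e \<in> inscribed_polytopes M (n + 2) \<and>
    polytope_B n e \<in> inscribed_polytopes M (n + 2) \<and>
    \<not> lattice_equivalent M (polytope_A n e) (polytope_B n e) \<and>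
    (\<forall>P \<in> inscribed_polytopes M (n + 2).
      lattice_equivalent M (polytope_A n e) P \<or> lattice_equivalent M (polytope_B n e) P)"
proof -
  let ?E = "e ` {1..n}"
  have inj: "inj_on e {1..n}" using assms(3) by (simp add: lattice_basis_seq_def)
  have E: "lattice_coordinates M ?E"
    using assms by (simp add: lattice_coordinates_def lattice_basis_seq_def lattice_of_rank_def)
  interpret lattice_coordinates M ?E by (rule E)
  have card: "card ?E = n" using inj by (simp add: card_image)
  have e12: "e 1 \<in> ?E" "e 2 \<in> ?E" "e 1 \<noteq> e 2"
    using assms(2) inj_on_eq_iff[OF inj, of 1 2] by auto
  have A: "polytope_A n e = convexQ hull (insert 0 (insert (e 1 + e 1) ?E))"
    using assms(2) by (intro polytope_A_eq) simp
  note B = polytope_B_eq[of n e]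
  have "polytope_A n e \<in> inscribed_polytopes M (n + 2)"
    using hull_inscribed[OF e12(1,1)] by (simp only: A card)
  moreover have "polytope_B n e \<in> inscribed_polytopes M (n + 2)"
    using hull_inscribed[OF e12(1,2)] by (simp only: B card)
  moreover have "\<not> lattice_equivalent M (polytope_A n e) (polytope_B n e)"
    unfolding B
  proof (rule not_lattice_equivalent[OF e12])
    show "e 1 \<in> M" "e 1 \<noteq> 0" using e12 basis_in_M zero_notin_U by metis+
    show "0 \<in> polytope_A n e" "e 1 + e 1 \<in> polytope_A n e" unfolding A by (rule hull_inc; simp)+
  qed
  moreover have "lattice_equivalent M (polytope_A n e) P \<or> lattice_equivalent M (polytope_B n e) P"
    if "P \<in> inscribed_polytopes M (n + 2)" for P
  proof -
    have "P \<in> inscribed_polytopes M (card ?E + 2)" using that by (simp only: card)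
    from inscribed_polytopes_classification[OF E this]
    obtain v0 U b c where *: "v0 \<in> M" "lattice_coordinates M U" "card ?E = card U" "b \<in> U" "c \<in> U"
      and P: "P = (\<lambda>x. v0 + x) ` (convexQ hull (insert 0 (insert (b + c) U)))" .
    show ?thesis
    proof (cases "b = c")
      case True
      then have "lattice_equivalent M (polytope_A n e) P"
        unfolding A P using * e12 by (intro lattice_equivalent_translated_hull) simp_all
      then show ?thesis ..
    next
      case False
      then have "lattice_equivalent M (polytope_B n e) P"
        unfolding B P using * e12 by (intro lattice_equivalent_translated_hull) simp_all
      then show ?thesis ..
    qed
  qed
  ultimately show ?thesis by blast
qed

end
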